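(* Let $\mathbf p_1,\dots,\mathbf p_K\in\Delta_n$ with $\|\log\mathbf p_k\|_2\le D_{\mathbf p}$ for all $k$, let $\mathbf U\in\mathbb R^{n\times K}$ satisfy $\|\mathbf U\mathbf e_k\|_1\le1$ for all $k$, and define $$\pi(\mathbf y,\sigma)=\sum_{k=1}^K\big\langle\mathbf U\mathbf e_k,\ \mathrm{softmax}(\mathbf y-\sigma\log\mathbf p_k)\big\rangle,\qquad \pi^*=\max\{\pi(\mathbf y,\sigma):\ \mathbf y\in[-D_{\mathbf y},D_{\mathbf y}]^n,\ \sigma\in[-1,D_\sigma]\}.$$ Given a tolerance $\epsilon\in(0,1)$, the grid-search algorithm is the following. Set $h=\epsilon/(KD_{\mathbf p})$ and $\Sigma_h=\{-1,-1+h,-1+2h,\dots\}\cap[-1,D_\sigma]$. For each $\sigma'\in\Sigma_h$, solve the linear fractional program $$\max_{\mathbf q\in[e^{-D_{\mathbf y}},e^{D_{\mathbf y}}]^n}\ \vartheta(\mathbf q)=\sum_{k=1}^K\frac{\langle\mathbf q,\boldsymbol\theta_k\rangle}{\langle\mathbf q,\mathbf f_k\rangle},\qquad \mathbf f_k=\mathbf p_k^{-\sigma'},\quad \boldsymbol\theta_k=\mathrm{diag}(\mathbf f_k)\mathbf U\mathbf e_k,$$ by the subroutine AppLFMP at relative tolerance $\delta=\epsilon/(2K)$, obtaining $\tilde{\mathbf q}(\sigma')$, and set $\tilde{\mathbf y}(\sigma')=\log\tilde{\mathbf q}(\sigma')$. Output $\hat\sigma\in\arg\max_{\sigma'\in\Sigma_h}\pi(\tilde{\mathbf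 y}(\sigma'),\sigma')$ and $\hat{\mathbf y}=\tilde{\mathbf y}(\hat\sigma)$. Then for any $\epsilon\in(0,1)$ and any fixed $K$, this algorithm returns an approximate solution $(\hat{\mathbf y},\hat\sigma)$ in $\tilde{\mathcal O}(\epsilon^{-(K+1)})$ time such that $$\pi(\hat{\mathbf y},\hat\sigma)\ge\pi^*-\epsilon .$$
   Context: $\Delta_n$ is the probability simplex in $\mathbb R^n$, $\mathbf e_k$ the $k$-th standard basis vector of $\mathbb R^K$, $\mathrm{softmax}(\mathbf v)=\exp(\mathbf v)/\sum_j\exp(v_j)$, and logs, exponentials and powers of vectors are componentwise. The constants $D_{\mathbf y},D_\sigma,D_{\mathbf p}\ge0$ are finite, and $|\sigma|\le D_\sigma$ for all admissible $\sigma$. Replacing every $\mathbf U\mathbf e_k$ by $\mathbf U\mathbf e_k+a\mathbf 1$ changes $\pi$ only by the constant $aK$, and on this ground the columns $\mathbf U\mathbf e_k$ are taken nonnegative, so that $\boldsymbol\theta_k\ge\mathbf 0$. AppLFMP is the fully polynomial-time approximation scheme of Depetrini and Locatelli (2011) for linear fractional-multiplicative minimization, applied here to minimizing $K-\vartheta(\mathbf q)$; solving at relative tolerance $\delta$ means returning $\tilde{\mathbf q}$ in the box with $K-\vartheta(\tilde{\mathbf q})\le(1+\delta)(K-\vartheta^* )$, where $\vartheta^*$ is the maximum of $\vartheta$, and this takes $\tilde{\mathcal O}(\delta^{-K})$ arithmetic operations. The notation $\tilde{\mathcal O}(\cdot)$ hides polynomial terms in fixed parameters. *)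

theory Defs
  imports "HOL-Analysis.Analysis" "HOL-Library.Monad_Syntax"
begin

section \<open>The optimization problem\<close>

text \<open>
  Since the running time is bounded uniformly in the dimension \<open>n\<close>, vectors in \<open>\<real>\<^sup>n\<close> are lists
  of length \<open>n\<close>, and the matrix \<open>U\<close> is the list of its columns \<open>U e\<^sub>1, \<dots>, U e\<^sub>K\<close>
  (indices start at 0).
\<close>

record problem =
  ndim  :: nat                \<comment> \<open>\<open>n\<close>\<close>
  bndy  :: real               \<comment> \<open>\<open>D\<^sub>y\<close>\<close>
  bnds  :: real               \<comment> \<open>\<open>D\<^sub>\<sigma>\<close>\<close>
  bndp  :: real               \<comment> \<open>\<open>D\<^sub>p\<close>\<close>
  probs :: "real list list"   \<comment> \<open>\<open>p\<^sub>1, \<dots>, p\<^sub>K\<close>\<close>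
  cols  :: "real list list"   \<comment> \<open>\<open>U e\<^sub>1, \<dots>, U e\<^sub>K\<close>\<close>

definition simplex_list :: "nat \<Rightarrow> real list set" where
  "simplex_list n = {p. length p = n \<and> (\<forall>i<n. 0 \<le> p ! i) \<and> (\<Sum>i<n. p ! i) = 1}"

text \<open>
  A finite bound on \<open>\<parallel>log p\<parallel>\<^sub>2\<close> forces \<open>p > 0\<close>. This has to be said explicitly, because
  \<open>ln 0 = 0\<close> in HOL.
\<close>

definition instances :: "nat \<Rightarrow> problem set" where
  "instances K = {X. 0 \<le> bndy X \<and> 0 \<le> bnds X \<and> 0 \<le> bndp X \<and>
     length (probs X) = K \<and> length (cols X) = K \<and>
     (\<forall>k<K. probs X ! k \<in> simplex_list (ndim X) \<and> (\<forall>i<ndim X. 0 < probs X ! k ! i) \<and>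
            L2_set (\<lambda>i. ln (probs X ! k ! i)) {..<ndim X} \<le> bndp X) \<and>
     (\<forall>k<K. length (cols X ! k) = ndim X \<and> (\<forall>i<ndim X. 0 \<le> cols X ! k ! i) \<and>
            (\<Sum>i<ndim X. \<bar>cols X ! k ! i\<bar>) \<le> 1)}"

definition dot :: "real list \<Rightarrow> real list \<Rightarrow> real" where
  "dot v w = (\<Sum>i<length v. v ! i * w ! i)"

definition softmax :: "real list \<Rightarrow> real list" where
  "softmax v = map (\<lambda>x. exp x / (\<Sum>j<length v. exp (v ! j))) v"

definition payoff :: "problem \<Rightarrow> real list \<Rightarrow> real \<Rightarrow> real" where
  "payoff X y \<sigma> = (\<Sum>k<length (probs X).
     dot (cols X ! k) (softmax (map (\<lambda>i. y ! i - \<sigma> * ln (probs X ! k ! i)) [0..<ndim X])))"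

definition vec_box :: "nat \<Rightarrow> real \<Rightarrow> real \<Rightarrow> real list set" where
  "vec_box n a b = {v. length v = n \<and> (\<forall>i<n. a \<le> v ! i \<and> v ! i \<le> b)}"

text \<open>
  The suprema below are maxima; see \<open>payoff_max_attained\<close> and \<open>lfp_max_attained\<close>.
\<close>

definition payoff_max :: "problem \<Rightarrow> real" where
  "payoff_max X = (SUP (y, \<sigma>) \<in> vec_box (ndim X) (- bndy X) (bndy X) \<times> {-1..bnds X}. payoff X y \<sigma>)"


section \<open>The linear fractional programs\<close>

definition fvecs :: "problem \<Rightarrow> real \<Rightarrow> real list list" where
  "fvecs X \<sigma> = map (map (\<lambda>x. x powr (- \<sigma>))) (probs X)"

definition thetas :: "problem \<Rightarrow> real \<Rightarrow> real list list" where
  "thetas X \<sigma> = map2 (map2 (*)) (fvecs X \<sigma>) (cols X)"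

definition lfp_obj :: "problem \<Rightarrow> real \<Rightarrow> real list \<Rightarrow> real" where
  "lfp_obj X \<sigma> q = (\<Sum>k<length (probs X). dot q (thetas X \<sigma> ! k) / dot q (fvecs X \<sigma> ! k))"

definition lfp_box :: "problem \<Rightarrow> real list set" where
  "lfp_box X = vec_box (ndim X) (exp (- bndy X)) (exp (bndy X))"

definition lfp_max :: "problem \<Rightarrow> real \<Rightarrow> real" where
  "lfp_max X \<sigma> = (SUP q \<in> lfp_box X. lfp_obj X \<sigma> q)"


section \<open>The suprema are maxima\<close>

lemma compact_box_fun:
  "compact (PiE UNIV (\<lambda>i::nat. if i < n then {a..b::real} else {0}))"
proof -
  have "compactin (product_topology (\<lambda>i::nat. euclidean) UNIV)
          (PiE UNIV (\<lambda>i::nat. if i < n then {a..b::real} else {0}))"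
    by (subst compactin_PiE) auto
  then show ?thesis
    by (simp add: euclidean_product_topology)
qed

lemma vec_box_conv:
  "vec_box n a b = (\<lambda>g. map g [0..<n]) ` PiE UNIV (\<lambda>i. if i < n then {a..b} else {0})"
proof (intro equalityI subsetI)
  fix v assume v: "v \<in> vec_box n a b"
  have "v = map (\<lambda>i. if i < n then v ! i else 0) [0..<n]"
    using v by (auto simp: vec_box_def intro: nth_equalityI)
  then show "v \<in> (\<lambda>g. map g [0..<n]) ` PiE UNIV (\<lambda>i. if i < n then {a..b} else {0})"
    using v by (intro image_eqI[where x = "\<lambda>i. if i < n then v ! i else 0"])
      (auto simp: vec_box_def)
next
  fix v assume "v \<in> (\<lambda>g. map g [0..<n]) ` PiE UNIV (\<lambda>i. if i < n then {a..b} else {0})"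
  then obtain g where g: "g \<in> PiE UNIV (\<lambda>i. if i < n then {a..b} else {0})" "v = map g [0..<n]"
    by blast
  have "g i \<in> {a..b}" if "i < n" for i
    using PiE_mem[OF g(1), of i] that by simp
  then show "v \<in> vec_box n a b"
    using g(2) by (auto simp: vec_box_def)
qed

lemma vec_box_nonempty: "a \<le> b \<Longrightarrow> replicate n a \<in> vec_box n a b"
  by (auto simp: vec_box_def)

lemma payoff_max_attained:
  assumes "X \<in> instances K"
  obtains y \<sigma> where "y \<in> vec_box (ndim X) (- bndy X) (bndy X)" "\<sigma> \<in> {-1..bnds X}"
    "payoff X y \<sigma> = payoff_max X"
    "\<forall>y' \<in> vec_box (ndim X) (- bndy X) (bndy X). \<forall>\<sigma>' \<in> {-1..bnds X}. payoff X y' \<sigma>' \<le> payoff X y \<sigma>"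
proof -
  let ?n = "ndim X"
  let ?B = "vec_box ?n (- bndy X) (bndy X)"
  define S where "S = PiE UNIV (\<lambda>i. if i < ?n then {- bndy X..bndy X} else {0}) \<times> {-1..bnds X}"
  define F where "F = (\<lambda>(g, s). payoff X (map g [0..<?n]) s)"
  have bnds: "0 \<le> bndy X" "0 \<le> bnds X"
    using assms by (auto simp: instances_def)
  have "continuous_on S F"
  proof -
    have co: "continuous_on S (\<lambda>x. fst x i)" for i :: nat
      by (rule continuous_on_product_then_coordinatewise) (intro continuous_intros)
    have "continuous_on S (\<lambda>x. \<Sum>k<length (probs X). \<Sum>i<length (cols X ! k). cols X ! k ! i *
        softmax (map (\<lambda>i. fst x i - snd x * ln (probs X ! k ! i)) [0..<?n]) ! i)"
    proof (intro continuous_intros)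
      fix k i assume "k \<in> {..<length (probs X)}" "i \<in> {..<length (cols X ! k)}"
      then have i: "i < ?n"
        using assms by (auto simp: instances_def)
      have "(\<Sum>j<?n. exp (f j)) \<noteq> 0" for f :: "nat \<Rightarrow> real"
      proof -
        have "0 < (\<Sum>j<?n. exp (f j))"
          using i by (intro sum_pos) auto
        then show ?thesis by simp
      qed
      then have "continuous_on S (\<lambda>x. exp (fst x i - snd x * ln (probs X ! k ! i)) /
            (\<Sum>j<?n. exp (fst x j - snd x * ln (probs X ! k ! j))))"
        by (intro continuous_intros co ballI)
      then show "continuous_on S
          (\<lambda>x. softmax (map (\<lambda>i. fst x i - snd x * ln (probs X ! k ! i)) [0..<?n]) ! i)"
        using i by (simp add: softmax_def)
    qed
    moreover have "F x = (\<Sum>k<length (probs X). \<Sum>i<length (cols X ! k). cols X ! k ! i *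
        softmax (map (\<lambda>i. fst x i - snd x * ln (probs X ! k ! i)) [0..<?n]) ! i)" for x
    proof -
      have "map (\<lambda>i. map (fst x) [0..<?n] ! i - snd x * ln (probs X ! k ! i)) [0..<?n] =
            map (\<lambda>i. fst x i - snd x * ln (probs X ! k ! i)) [0..<?n]" for k
        by (rule map_cong) auto
      then show ?thesis
        unfolding F_def payoff_def dot_def case_prod_unfold by presburger
    qed
    ultimately show ?thesis
      by presburger
  qed
  moreover have "compact S"
    unfolding S_def by (intro compact_Times compact_box_fun compact_Icc)
  moreover have "S \<noteq> {}"
  proof -
    have "(\<lambda>_. 0, 0) \<in> S"
      unfolding S_def using bnds by auto
    then show ?thesis by blast
  qed
  ultimately obtain z where z: "z \<in> S" "\<forall>x\<in>S. F x \<le> F z"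
    using continuous_attains_sup by blast
  have BS: "\<exists>x\<in>S. payoff X y s = F x" if "y \<in> ?B" "s \<in> {-1..bnds X}" for y s
  proof -
    from that(1) obtain g where "g \<in> PiE UNIV (\<lambda>i. if i < ?n then {- bndy X..bndy X} else {0})"
      "y = map g [0..<?n]"
      unfolding vec_box_conv by blast
    with that(2) show ?thesis
      unfolding S_def F_def by (intro bexI[where x = "(g, s)"]) auto
  qed
  define y where "y = map (fst z) [0..<?n]"
  define s where "s = snd z"
  have ys: "y \<in> ?B" "s \<in> {-1..bnds X}" "payoff X y s = F z"
    using z(1) unfolding vec_box_conv S_def F_def y_def s_def by (auto simp: case_prod_unfold)
  have max: "\<forall>y' \<in> ?B. \<forall>s' \<in> {-1..bnds X}. payoff X y' s' \<le> payoff X y s"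
    using BS z(2) ys(3) by fastforce
  have "payoff_max X = payoff X y s"
    unfolding payoff_max_def
  proof (rule cSup_eq_maximum)
    show "payoff X y s \<in> (\<lambda>(y, s). payoff X y s) ` (?B \<times> {-1..bnds X})"
      using ys by (intro image_eqI[where x = "(y, s)"]) auto
  qed (use max in auto)
  with ys max that show ?thesis
    by metis
qed

lemma lfp_max_attained:
  assumes "X \<in> instances K"
  obtains q where "q \<in> lfp_box X" "lfp_obj X \<sigma> q = lfp_max X \<sigma>"
    "\<forall>q' \<in> lfp_box X. lfp_obj X \<sigma> q' \<le> lfp_obj X \<sigma> q"
proof -
  let ?n = "ndim X"
  define S where "S = PiE UNIV (\<lambda>i. if i < ?n then {exp (- bndy X)..exp (bndy X)} else {0})"
  define F where "F = (\<lambda>g. lfp_obj X \<sigma> (map g [0..<?n]))"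
  have le: "exp (- bndy X) \<le> exp (bndy X)"
    using assms by (auto simp: instances_def)
  have "continuous_on S F"
  proof -
    have co: "continuous_on S (\<lambda>x. x i)" for i :: nat
      by (rule continuous_on_product_then_coordinatewise) (intro continuous_intros)
    have "continuous_on S (\<lambda>g. (\<Sum>i<?n. g i * thetas X \<sigma> ! k ! i) / (\<Sum>i<?n. g i * fvecs X \<sigma> ! k ! i))"
      if k: "k < length (probs X)" for k
    proof (intro continuous_intros co ballI)
      fix g assume g: "g \<in> S"
      have p: "length (probs X ! k) = ?n" "\<forall>i<?n. 0 < probs X ! k ! i" "(\<Sum>i<?n. probs X ! k ! i) = 1"
        using k assms by (auto simp: instances_def simplex_list_def)
      have "?n \<noteq> 0"
        using p(3) by (intro notI) simp
      then have "0 < (\<Sum>i<?n. g i * fvecs X \<sigma> ! k ! i)"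
      proof (intro sum_pos)
        fix i assume "i \<in> {..<?n}"
        then have i: "i < ?n" by simp
        have "exp (- bndy X) \<le> g i"
          using PiE_mem[OF g[unfolded S_def], of i] i by simp
        then have "0 < g i"
          using exp_gt_zero[of "- bndy X"] by linarith
        moreover have "0 < fvecs X \<sigma> ! k ! i"
          using i k p by (auto simp: fvecs_def dest!: spec[of _ i])
        ultimately show "0 < g i * fvecs X \<sigma> ! k ! i"
          by simp
      qed (auto simp: lessThan_empty_iff)
      then show "(\<Sum>i<?n. g i * fvecs X \<sigma> ! k ! i) \<noteq> 0"
        by simp
    qed
    then have "continuous_on S (\<lambda>g. \<Sum>k<length (probs X).
        (\<Sum>i<?n. g i * thetas X \<sigma> ! k ! i) / (\<Sum>i<?n. g i * fvecs X \<sigma> ! k ! i))"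
      by (intro continuous_on_sum) auto
    then show ?thesis
      by (simp add: F_def lfp_obj_def dot_def)
  qed
  moreover have "compact S"
    unfolding S_def by (rule compact_box_fun)
  moreover have box: "lfp_box X = (\<lambda>g. map g [0..<?n]) ` S"
    unfolding lfp_box_def S_def by (rule vec_box_conv)
  moreover have "S \<noteq> {}"
    using vec_box_nonempty[OF le, of ?n] box unfolding lfp_box_def by blast
  ultimately obtain g where g: "g \<in> S" "\<forall>x\<in>S. F x \<le> F g"
    using continuous_attains_sup by blast
  define q where "q = map g [0..<?n]"
  have q: "q \<in> lfp_box X" "\<forall>q' \<in> lfp_box X. lfp_obj X \<sigma> q' \<le> lfp_obj X \<sigma> q"
    using g unfolding box F_def q_def by auto
  moreover have "lfp_max X \<sigma> = lfp_obj X \<sigma> q"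
    unfolding lfp_max_def by (rule cSup_eq_maximum) (use q in auto)
  ultimately show ?thesis
    using that by metis
qed


section \<open>Counting arithmetic operations\<close>

text \<open>A computation is its result together with the number of arithmetic operations it performs.\<close>

datatype 'a cmp = Cmp (val: 'a) (ops: nat)

definition bind_cmp :: "'a cmp \<Rightarrow> ('a \<Rightarrow> 'b cmp) \<Rightarrow> 'b cmp" where
  "bind_cmp c f = Cmp (val (f (val c))) (ops c + ops (f (val c)))"

adhoc_overloading Monad_Syntax.bind \<rightleftharpoons> bind_cmp

definition ret :: "'a \<Rightarrow> 'a cmp" where
  "ret x = Cmp x 0"

text \<open>
  One operation. In the programs below the argument of \<open>op1\<close> is always a single application of
  \<open>+\<close>, \<open>-\<close>, \<open>*\<close>, \<open>/\<close>, \<open>exp\<close>, \<open>ln\<close>, \<open>powr\<close> or a comparison to values already computed.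
\<close>

definition op1 :: "'a \<Rightarrow> 'a cmp" where
  "op1 x = Cmp x 1"

text \<open>
  Rounding down is not a unit-cost operation: it is charged the number of comparisons needed to
  find \<open>\<lfloor>x\<rfloor>\<close>, for \<open>x \<ge> 0\<close>, by counting upwards.
\<close>

definition floor_cmp :: "real \<Rightarrow> nat cmp" where
  "floor_cmp x = Cmp (nat \<lfloor>x\<rfloor>) (nat \<lfloor>x\<rfloor> + 1)"

fun map_cmp :: "('a \<Rightarrow> 'b cmp) \<Rightarrow> 'a list \<Rightarrow> 'b list cmp" where
  "map_cmp f [] = ret []"
| "map_cmp f (x # xs) = do { y \<leftarrow> f x; ys \<leftarrow> map_cmp f xs; ret (y # ys) }"

definition map2_cmp :: "('a \<Rightarrow> 'b \<Rightarrow> 'c cmp) \<Rightarrow> 'a list \<Rightarrow> 'b list \<Rightarrow> 'c list cmp" where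
  "map2_cmp f xs ys = map_cmp (\<lambda>(x, y). f x y) (zip xs ys)"

fun sum_cmp :: "real list \<Rightarrow> real cmp" where
  "sum_cmp [] = ret 0"
| "sum_cmp (x # xs) = do { s \<leftarrow> sum_cmp xs; op1 (x + s) }"

definition dot_cmp :: "real list \<Rightarrow> real list \<Rightarrow> real cmp" where
  "dot_cmp v w = do { zs \<leftarrow> map2_cmp (\<lambda>a b. op1 (a * b)) v w; sum_cmp zs }"

definition softmax_cmp :: "real list \<Rightarrow> real list cmp" where
  "softmax_cmp v = do {
     es \<leftarrow> map_cmp (\<lambda>x. op1 (exp x)) v;
     s \<leftarrow> sum_cmp es;
     map_cmp (\<lambda>e. op1 (e / s)) es }"


section \<open>The grid-search algorithm\<close>

text \<open>
  A subroutine for the linear fractional programs receives the two ends of the box interval, the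
  numerator vectors, the denominator vectors and the relative tolerance.
\<close>

type_synonym lfp_solver =
  "real \<Rightarrow> real \<Rightarrow> real list list \<Rightarrow> real list list \<Rightarrow> real \<Rightarrow> real list cmp"

definition payoff_cmp :: "problem \<Rightarrow> real list \<Rightarrow> real \<Rightarrow> real cmp" where
  "payoff_cmp X y \<sigma> = do {
     ts \<leftarrow> map2_cmp (\<lambda>p u. do {
         z \<leftarrow> map2_cmp (\<lambda>a b. do { l \<leftarrow> op1 (ln b); m \<leftarrow> op1 (\<sigma> * l); op1 (a - m) }) y p;
         s \<leftarrow> softmax_cmp z;
         dot_cmp u s }) (probs X) (cols X);
     sum_cmp ts }"

definition candidate_cmp :: "lfp_solver \<Rightarrow> problem \<Rightarrow> real \<Rightarrow> real \<Rightarrow> real list cmp" where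
  "candidate_cmp app X \<delta> \<sigma> = do {
     s \<leftarrow> op1 (- \<sigma>);
     fs \<leftarrow> map_cmp (map_cmp (\<lambda>x. op1 (x powr s))) (probs X);
     ts \<leftarrow> map2_cmp (map2_cmp (\<lambda>a b. op1 (a * b))) fs (cols X);
     d \<leftarrow> op1 (- bndy X);
     lo \<leftarrow> op1 (exp d);
     hi \<leftarrow> op1 (exp (bndy X));
     q \<leftarrow> app lo hi ts fs \<delta>;
     map_cmp (\<lambda>x. op1 (ln x)) q }"

fun grid_cmp :: "nat \<Rightarrow> real \<Rightarrow> real \<Rightarrow> real list cmp" where
  "grid_cmp 0 h s = ret [s]"
| "grid_cmp (Suc N) h s = do { s' \<leftarrow> op1 (s + h); ss \<leftarrow> grid_cmp N h s'; ret (s # ss) }"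

fun argmax_cmp :: "'a \<times> real \<Rightarrow> ('a \<times> real) list \<Rightarrow> 'a cmp" where
  "argmax_cmp c [] = ret (fst c)"
| "argmax_cmp c (d # ds) = do {
     b \<leftarrow> op1 (snd c < snd d);
     argmax_cmp (if b then d else c) ds }"

definition grid_search :: "lfp_solver \<Rightarrow> problem \<Rightarrow> real \<Rightarrow> (real list \<times> real) cmp" where
  "grid_search app X \<epsilon> = do {
     a \<leftarrow> op1 (real (length (probs X)) * bndp X);
     h \<leftarrow> op1 (\<epsilon> / a);
     b \<leftarrow> op1 (2 * real (length (probs X)));
     \<delta> \<leftarrow> op1 (\<epsilon> / b);
     w \<leftarrow> op1 (bnds X + 1);
     r \<leftarrow> op1 (w / h);
     N \<leftarrow> floor_cmp r;
     \<Sigma> \<leftarrow> grid_cmp N h (-1);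
     cs \<leftarrow> map_cmp (\<lambda>\<sigma>. do {
         y \<leftarrow> candidate_cmp app X \<delta> \<sigma>;
         v \<leftarrow> payoff_cmp X y \<sigma>;
         ret ((y, \<sigma>), v) }) \<Sigma>;
     argmax_cmp (hd cs) (tl cs) }"

text \<open>
  The program above resolves ties in the final \<open>argmax\<close> in one particular way. The following
  predicate describes all admissible outputs. If \<open>D\<^sub>p = 0\<close> (which forces \<open>n = 1\<close>), then
  \<open>h = \<epsilon> / 0 = 0\<close> and the grid is \<open>{-1}\<close>.
\<close>

definition sigma_grid :: "problem \<Rightarrow> real \<Rightarrow> real set" where
  "sigma_grid X \<epsilon> =
     (let h = \<epsilon> / (real (length (probs X)) * bndp X)
      in {-1 + real j * h | j :: nat. True} \<inter> {-1..bnds X})"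

definition candidate :: "lfp_solver \<Rightarrow> problem \<Rightarrow> real \<Rightarrow> real \<Rightarrow> real list" where
  "candidate app X \<epsilon> \<sigma> =
     map ln (val (app (exp (- bndy X)) (exp (bndy X)) (thetas X \<sigma>) (fvecs X \<sigma>)
                      (\<epsilon> / (2 * real (length (probs X))))))"

definition grid_search_output ::
  "lfp_solver \<Rightarrow> problem \<Rightarrow> real \<Rightarrow> real list \<times> real \<Rightarrow> bool" where
  "grid_search_output app X \<epsilon> = (\<lambda>(y, \<sigma>).
     is_arg_max (\<lambda>s. payoff X (candidate app X \<epsilon> s) s) (\<lambda>s. s \<in> sigma_grid X \<epsilon>) \<sigma> \<and>
     y = candidate app X \<epsilon> \<sigma>)"


section \<open>Complexity\<close>

text \<open>
  \<open>soft_O S par T g\<close> says that \<open>T = O(g)\<close> on the inputs \<open>S\<close> up to a factor polynomial in the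
  parameters. All parameters are nonnegative, so a polynomial in \<open>n, D\<^sub>y, D\<^sub>\<sigma>, D\<^sub>p\<close> is
  expressed by a power of \<open>1 + n + D\<^sub>y + D\<^sub>\<sigma> + D\<^sub>p\<close>. The number \<open>K\<close> is fixed in each use, so the
  constants may depend on it.
\<close>

definition soft_O :: "'a set \<Rightarrow> ('a \<Rightarrow> real) \<Rightarrow> ('a \<Rightarrow> real) \<Rightarrow> ('a \<Rightarrow> real) \<Rightarrow> bool" where
  "soft_O S par T g \<longleftrightarrow> (\<exists>C m. \<forall>x\<in>S. T x \<le> C * (1 + par x) ^ m * g x)"

definition params :: "problem \<Rightarrow> real" where
  "params X = real (ndim X) + bndy X + bnds X + bndp X"

text \<open>
  The contract of the approximation scheme for minimizing \<open>K - \<vartheta>(q)\<close> over the box at relative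
  tolerance \<open>\<delta>\<close>.
\<close>

definition is_AppLFMP :: "nat \<Rightarrow> lfp_solver \<Rightarrow> bool" where
  "is_AppLFMP K app \<longleftrightarrow>
     (let I = {(X, \<sigma>, \<delta>). X \<in> instances K \<and> \<sigma> \<in> {-1..bnds X} \<and> \<delta> \<in> {0<..<1}};
          run = (\<lambda>X \<sigma> \<delta>. app (exp (- bndy X)) (exp (bndy X)) (thetas X \<sigma>) (fvecs X \<sigma>) \<delta>)
      in (\<forall>(X, \<sigma>, \<delta>) \<in> I.
            val (run X \<sigma> \<delta>) \<in> lfp_box X \<and>
            real K - lfp_obj X \<sigma> (val (run X \<sigma> \<delta>)) \<le> (1 + \<delta>) * (real K - lfp_max X \<sigma>)) \<and>
         soft_O I (\<lambda>(X, \<sigma>, \<delta>). params X)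
                  (\<lambda>(X, \<sigma>, \<delta>). real (ops (run X \<sigma> \<delta>)))
                  (\<lambda>(X, \<sigma>, \<delta>). (1 / \<delta>) ^ K))"

end

theory Submission
  imports Defs
begin

text \<open>
  Under \<open>q = exp y\<close> the payoff at a fixed \<open>\<sigma>\<close> becomes the objective of the linear fractional
  program, whose maximum is nonnegative, so relative tolerance \<open>\<epsilon> / (2K)\<close> on \<open>K - \<vartheta>\<close> costs at most
  \<open>\<epsilon> / 2\<close>. A softmax weight \<open>s\<close> moves in \<open>\<sigma>\<close> at rate at most \<open>D\<^sub>p s (1 - s) \<le> D\<^sub>p / 4\<close>, and each
  column of \<open>U\<close> is nonnegative of mass at most one, so the payoff is \<open>K D\<^sub>p / 4\<close>-Lipschitz in \<open>\<sigma>\<close> and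
  rounding \<open>\<sigma>\<close> down to a grid of mesh \<open>\<epsilon> / (K D\<^sub>p)\<close> costs at most \<open>\<epsilon> / 4\<close>.
  The grid has \<open>O(K D\<^sub>p (1 + D\<^sub>\<sigma>) / \<epsilon>)\<close> points, each costing \<open>O(nK)\<close> operations and one call of
  the subroutine.
\<close>

section \<open>Values and operation counts\<close>

lemma val_bind_cmp [simp]: "val (bind_cmp c f) = val (f (val c))"
  and ops_bind_cmp [simp]: "ops (bind_cmp c f) = ops c + ops (f (val c))"
  by (simp_all add: bind_cmp_def)

lemma val_ret [simp]: "val (ret x) = x" and ops_ret [simp]: "ops (ret x) = 0"
  by (simp_all add: ret_def)

lemma val_op1 [simp]: "val (op1 x) = x" and ops_op1 [simp]: "ops (op1 x) = 1"
  by (simp_all add: op1_def)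

lemma val_map_cmp [simp]: "val (map_cmp f xs) = map (\<lambda>x. val (f x)) xs"
  by (induction xs) auto

lemma ops_map_cmp_const: "(\<And>x. x \<in> set xs \<Longrightarrow> ops (f x) = c) \<Longrightarrow> ops (map_cmp f xs) = length xs * c"
  by (induction xs) auto

lemma ops_map_cmp_le: "(\<And>x. x \<in> set xs \<Longrightarrow> ops (f x) \<le> c) \<Longrightarrow> ops (map_cmp f xs) \<le> length xs * c"
  by (induction xs) (auto intro: add_mono)

lemma val_map2_cmp [simp]: "val (map2_cmp f xs ys) = map2 (\<lambda>x y. val (f x y)) xs ys"
  by (simp add: map2_cmp_def case_prod_unfold)

lemma ops_map2_cmp_const:
  "(\<And>x y. (x, y) \<in> set (zip xs ys) \<Longrightarrow> ops (f x y) = c) \<Longrightarrow>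
    ops (map2_cmp f xs ys) = min (length xs) (length ys) * c"
  unfolding map2_cmp_def by (subst ops_map_cmp_const[where c = c]) auto

lemma val_sum_cmp [simp]: "val (sum_cmp xs) = sum_list xs"
  and ops_sum_cmp [simp]: "ops (sum_cmp xs) = length xs"
  by (induction xs) auto

lemma val_dot_cmp: "length v = length w \<Longrightarrow> val (dot_cmp v w) = dot v w"
  by (simp add: dot_cmp_def dot_def sum_list_sum_nth atLeast0LessThan)

lemma ops_dot_cmp: "length v = length w \<Longrightarrow> ops (dot_cmp v w) = 2 * length v"
  by (simp add: dot_cmp_def ops_map2_cmp_const[where c = 1])

lemma length_softmax [simp]: "length (softmax v) = length v"
  by (simp add: softmax_def)

lemma val_softmax_cmp [simp]: "val (softmax_cmp v) = softmax v"
  by (simp add: softmax_cmp_def softmax_def sum_list_sum_nth atLeast0LessThan)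

lemma ops_softmax_cmp [simp]: "ops (softmax_cmp v) = 3 * length v"
  by (simp add: softmax_cmp_def ops_map_cmp_const[where c = 1])

lemma val_grid_cmp: "val (grid_cmp N h s) = map (\<lambda>j. s + real j * h) [0..<Suc N]"
proof (induction N arbitrary: s)
  case (Suc N)
  \<comment> \<open>\<open>grid_cmp\<close> builds the list from the front, whereas
    \<open>upt_Suc\<close> splits off the last index. Shifting the indices makes the point
    \<open>s\<close> the head and lets the induction hypothesis apply at
    \<open>s + h\<close>.\<close>
  have "[0..<Suc (Suc N)] = 0 # map Suc [0..<Suc N]"
    by (metis map_Suc_upt upt_rec zero_less_Suc)
  then show ?case
    by (simp add: Suc.IH algebra_simps del: upt_Suc)
qed simp

lemma ops_grid_cmp [simp]: "ops (grid_cmp N h s) = N"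
  by (induction N arbitrary: s) auto

text \<open>The accumulator \<open>c\<close> is the best pair seen so far, so the induction must
  leave it arbitrary. The comparison is strict, hence the earliest of several maximisers
  survives.\<close>

lemma val_argmax_cmp:
  obtains d where "d \<in> set (c # ds)" "val (argmax_cmp c ds) = fst d"
    "\<And>e. e \<in> set (c # ds) \<Longrightarrow> snd e \<le> snd d"
proof (induction ds arbitrary: c thesis)
  case Nil
  then show ?case by auto
next
  case (Cons d ds)
  obtain m where m: "m \<in> set ((if snd c < snd d then d else c) # ds)"
    "val (argmax_cmp (if snd c < snd d then d else c) ds) = fst m"
    "\<And>e. e \<in> set ((if snd c < snd d then d else c) # ds) \<Longrightarrow> snd e \<le> snd m"
    using Cons.IH by blast
  \<comment> \<open>Of \<open>c\<close> and \<open>d\<close> the smaller is dropped, but it is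
    dominated by the one kept, which \<open>m\<close> dominates in turn.\<close>
  have "snd e \<le> snd m" if "e \<in> set (c # d # ds)" for e
    using that m(3)[of e] m(3)[of "if snd c < snd d then d else c"] by (auto split: if_splits)
  then show ?case
    using m(1,2) by (intro Cons.prems[of m]) (auto split: if_splits)
qed

lemma ops_argmax_cmp [simp]: "ops (argmax_cmp c ds) = length ds"
  by (induction ds arbitrary: c) auto


section \<open>The payoff\<close>

lemma instancesD:
  assumes "X \<in> instances K"
  shows "0 \<le> bndy X" "0 \<le> bnds X" "0 \<le> bndp X" "length (probs X) = K" "length (cols X) = K"
    and "\<And>k. k < K \<Longrightarrow> length (probs X ! k) = ndim X"
    and "\<And>k. k < K \<Longrightarrow> length (cols X ! k) = ndim X"
    and "\<And>k i. k < K \<Longrightarrow> i < ndim X \<Longrightarrow> 0 < probs X ! k ! i"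
    and "\<And>k i. k < K \<Longrightarrow> i < ndim X \<Longrightarrow> 0 \<le> cols X ! k ! i"
    and "\<And>k. k < K \<Longrightarrow> (\<Sum>i<ndim X. cols X ! k ! i) \<le> 1"
  using assms by (auto simp: instances_def simplex_list_def)

text \<open>Entries of a probability vector are at most one, and a coordinate is at most the
  Euclidean norm in absolute value. Knowing the sign matters: two such logarithms then differ by at
  most \<open>bndp X\<close>, not twice that.\<close>

lemma log_prob_bounds:
  assumes X: "X \<in> instances K" and k: "k < K" and i: "i < ndim X"
  shows "- bndp X \<le> ln (probs X ! k ! i)" "ln (probs X ! k ! i) \<le> 0"
proof -
  let ?p = "probs X ! k"
  have p: "\<And>i. i < ndim X \<Longrightarrow> 0 \<le> ?p ! i" "(\<Sum>i<ndim X. ?p ! i) = 1"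
    "L2_set (\<lambda>i. ln (?p ! i)) {..<ndim X} \<le> bndp X"
    using X k by (auto simp: instances_def simplex_list_def)
  have "?p ! i \<le> (\<Sum>i<ndim X. ?p ! i)"
    using i p(1) by (intro member_le_sum) auto
  then show "ln (?p ! i) \<le> 0"
    using p(2) instancesD(8)[OF X k i] by simp
  \<comment> \<open>\<open>member_le_L2_set\<close> bounds a coordinate from above only, so absolute
    values are taken first.\<close>
  have "\<bar>ln (?p ! i)\<bar> \<le> L2_set (\<lambda>i. \<bar>ln (?p ! i)\<bar>) {..<ndim X}"
    using i by (intro member_le_L2_set) auto
  also have "\<dots> = L2_set (\<lambda>i. ln (?p ! i)) {..<ndim X}"
    by (simp add: L2_set_def)
  finally show "- bndp X \<le> ln (?p ! i)"
    using p(3) by simp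
qed

section \<open>The payoff at fixed \<sigma> as a linear fractional objective\<close>

lemma payoff_eq:
  assumes "X \<in> instances K"
  shows "payoff X y \<sigma> = (\<Sum>k<K. \<Sum>i<ndim X. cols X ! k ! i *
    (exp (y ! i - \<sigma> * ln (probs X ! k ! i)) / (\<Sum>j<ndim X. exp (y ! j - \<sigma> * ln (probs X ! k ! j)))))"
  by (simp add: payoff_def dot_def softmax_def instancesD[OF assms])

lemma lfp_obj_eq:
  assumes X: "X \<in> instances K" and q: "length q = ndim X"
  shows "lfp_obj X \<sigma> q = (\<Sum>k<K.
    (\<Sum>i<ndim X. q ! i * (probs X ! k ! i powr (- \<sigma>) * cols X ! k ! i)) /
    (\<Sum>i<ndim X. q ! i * probs X ! k ! i powr (- \<sigma>)))"
  by (simp add: lfp_obj_def dot_def thetas_def fvecs_def instancesD[OF X] q)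

lemma lfp_box_pos: "q \<in> lfp_box X \<Longrightarrow> i < ndim X \<Longrightarrow> 0 < q ! i"
  by (auto simp: lfp_box_def vec_box_def intro: less_le_trans[OF exp_gt_zero])

text \<open>For positive \<open>q\<close> the exponential of \<open>ln q - \<sigma> * ln p\<close>
  is \<open>q * p powr (- \<sigma>)\<close>, so the softmax quotients are the fractions of the
  program term by term.\<close>

lemma payoff_ln:
  assumes X: "X \<in> instances K" and q: "q \<in> lfp_box X"
  shows "payoff X (map ln q) \<sigma> = lfp_obj X \<sigma> q"
proof -
  have len: "length q = ndim X"
    using q by (simp add: lfp_box_def vec_box_def)
  have e: "exp (map ln q ! i - \<sigma> * ln (probs X ! k ! i)) = q ! i * probs X ! k ! i powr (- \<sigma>)"
    if "k < K" "i < ndim X" for k i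
    using lfp_box_pos[OF q that(2)] instancesD(8)[OF X that] that len
    by (simp add: powr_def exp_diff exp_minus field_simps)
  show ?thesis
    unfolding payoff_eq[OF X] lfp_obj_eq[OF X len] sum_divide_distrib
    by (intro sum.cong refl) (simp add: e mult_ac)
qed

text \<open>This is where the nonnegative columns enter the tolerance analysis: it gives
  \<open>K - lfp_max X \<sigma> \<le> K\<close>, which turns a relative error into an additive
  one.\<close>

lemma lfp_max_nonneg:
  assumes X: "X \<in> instances K"
  shows "0 \<le> lfp_max X \<sigma>"
proof -
  obtain q where q: "q \<in> lfp_box X" "lfp_obj X \<sigma> q = lfp_max X \<sigma>"
    using lfp_max_attained[OF X] by metis
  have len: "length q = ndim X"
    using q by (simp add: lfp_box_def vec_box_def)
  have "0 \<le> lfp_obj X \<sigma> q"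
    unfolding lfp_obj_eq[OF X len] using instancesD(9)[OF X] lfp_box_pos[OF q(1)]
    by (intro sum_nonneg divide_nonneg_nonneg mult_nonneg_nonneg) (auto intro: less_imp_le)
  with q show ?thesis by simp
qed

text \<open>Componentwise \<open>exp\<close> sends the box for \<open>y\<close> into the box for
  \<open>q\<close>, and \<open>ln\<close> undoes it.\<close>

lemma payoff_le_lfp_max:
  assumes X: "X \<in> instances K" and y: "y \<in> vec_box (ndim X) (- bndy X) (bndy X)"
  shows "payoff X y \<sigma> \<le> lfp_max X \<sigma>"
proof -
  have "map exp y \<in> lfp_box X"
    using y by (auto simp: lfp_box_def vec_box_def)
  moreover have "map ln (map exp y) = y"
    by (simp add: map_idI)
  ultimately show ?thesis
    using payoff_ln[OF X, of "map exp y" \<sigma>] lfp_max_attained[OF X] by metis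
qed

section \<open>Lipschitz dependence of the payoff on \<sigma>\<close>

text \<open>The derivative of a weight \<open>g\<close> is \<open>g\<close> times the weighted mean
  of \<open>l j - l i\<close>. The index \<open>i\<close> contributes nothing to this mean, so it is
  at most \<open>D * (1 - g)\<close> in absolute value, and
  \<open>g * (1 - g) \<le> 1 / 4\<close>.\<close>

lemma softmax_weight_lipschitz:
  fixes y l :: "nat \<Rightarrow> real"
  assumes i: "i < n" and D: "\<And>j. j < n \<Longrightarrow> \<bar>l j - l i\<bar> \<le> D"
  defines "g \<equiv> \<lambda>s. exp (y i - s * l i) / (\<Sum>j<n. exp (y j - s * l j))"
  shows "\<bar>g s - g t\<bar> \<le> D / 4 * \<bar>s - t\<bar>"
proof -
  define e where "e = (\<lambda>s j. exp (y j - s * l j))"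
  define S where "S = (\<lambda>s. \<Sum>j<n. e s j)"
  define g' where "g' = (\<lambda>s. e s i / (S s)\<^sup>2 * (\<Sum>j<n. (l j - l i) * e s j))"
  have e_pos: "0 < e s j" for s j
    by (simp add: e_def)
  have S_pos: "0 < S s" for s
    unfolding S_def using i e_pos by (intro sum_pos) auto
  have e_deriv: "((\<lambda>s. e s j) has_field_derivative - l j * e s j) (at s)" for s j
    unfolding e_def by (auto intro!: derivative_eq_intros)
  have S_deriv: "(S has_field_derivative (\<Sum>j<n. - l j * e s j)) (at s)" for s
    unfolding S_def by (intro DERIV_sum e_deriv)
  have deriv: "(g has_field_derivative g' s) (at s)" for s
  proof -
    have "((\<lambda>s. e s i / S s) has_field_derivative
        (- l i * e s i * S s - e s i * (\<Sum>j<n. - l j * e s j)) / (S s * S s)) (at s)"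
      using S_pos[of s] by (intro DERIV_divide e_deriv S_deriv) simp
    moreover have "(- l i * e s i * S s - e s i * (\<Sum>j<n. - l j * e s j)) / (S s * S s) = g' s"
    proof -
      have "(\<Sum>j<n. (l j - l i) * e s j) = (\<Sum>j<n. l j * e s j) - l i * S s"
        by (simp add: S_def left_diff_distrib sum_subtractf sum_distrib_left)
      then have "g' s = e s i / (S s)\<^sup>2 * ((\<Sum>j<n. l j * e s j) - l i * S s)"
        by (simp only: g'_def)
      then show ?thesis
        using S_pos[of s] by (simp add: power2_eq_square sum_negf field_simps)
    qed
    ultimately show ?thesis
      by (simp add: g_def e_def S_def)
  qed
  have bound: "\<bar>g' s\<bar> \<le> D / 4" for s
  proof -
    have D0: "0 \<le> D"
      using D[OF i] by simp
    have "\<bar>\<Sum>j<n. (l j - l i) * e s j\<bar> \<le> (\<Sum>j\<in>{..<n} - {i}. D * e s j)"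
    proof -
      \<comment> \<open>Dropping the vanishing term at \<open>i\<close> leaves total mass
        \<open>S s - e s i\<close>, the source of the factor \<open>1 - g\<close>.\<close>
      have "(\<Sum>j<n. (l j - l i) * e s j) = (\<Sum>j\<in>{..<n} - {i}. (l j - l i) * e s j)"
        using i by (simp add: sum.remove[of _ i])
      also have "\<bar>\<dots>\<bar> \<le> (\<Sum>j\<in>{..<n} - {i}. \<bar>(l j - l i) * e s j\<bar>)"
        by (rule sum_abs)
      also have "\<dots> \<le> (\<Sum>j\<in>{..<n} - {i}. D * e s j)"
        using D by (intro sum_mono) (auto simp: abs_mult abs_of_pos[OF e_pos] less_imp_le[OF e_pos]
          intro!: mult_right_mono)
      finally show ?thesis .
    qed
    also have "\<dots> = D * (S s - e s i)"
      using i by (simp add: S_def sum_distrib_left[symmetric] sum.remove[of _ i])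
    finally have "\<bar>g' s\<bar> \<le> e s i / (S s)\<^sup>2 * (D * (S s - e s i))"
      unfolding g'_def abs_mult using e_pos[of s i] by (intro mult_mono) auto
    also have "\<dots> = D * (e s i * (S s - e s i)) / (S s)\<^sup>2"
      by simp
    also have "\<dots> \<le> D * ((S s)\<^sup>2 / 4) / (S s)\<^sup>2"
    proof -
      \<comment> \<open>Expanding this square is the inequality of arithmetic and geometric means
        for \<open>e s i\<close> and \<open>S s - e s i\<close>.\<close>
      have "0 \<le> (S s - 2 * e s i)\<^sup>2" by simp
      then have "e s i * (S s - e s i) \<le> (S s)\<^sup>2 / 4"
        by (simp add: power2_eq_square algebra_simps)
      then show ?thesis
        using D0 by (intro divide_right_mono mult_left_mono) auto
    qed
    also have "\<dots> = D / 4"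
      using S_pos[of s] by simp
    finally show ?thesis .
  qed
  show ?thesis
    using field_differentiable_bound[of UNIV g g' "D / 4" s t] deriv bound by simp
qed

text \<open>Each column combines the changes of the weights with nonnegative coefficients of total
  at most one, so it adds at most the bound for a single weight; there are \<open>K\<close>
  columns.\<close>

lemma payoff_lipschitz:
  assumes X: "X \<in> instances K"
  shows "\<bar>payoff X y s - payoff X y t\<bar> \<le> real K * bndp X / 4 * \<bar>s - t\<bar>"
proof -
  let ?n = "ndim X" and ?B = "bndp X / 4 * \<bar>s - t\<bar>"
  define w where "w = (\<lambda>s k i. exp (y ! i - s * ln (probs X ! k ! i)) /
    (\<Sum>j<?n. exp (y ! j - s * ln (probs X ! k ! j))))"
  have "\<bar>payoff X y s - payoff X y t\<bar> =
      \<bar>\<Sum>k<K. \<Sum>i<?n. cols X ! k ! i * (w s k i - w t k i)\<bar>"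
    by (simp add: payoff_eq[OF X] w_def sum_subtractf right_diff_distrib)
  also have "\<dots> \<le> (\<Sum>k<K. \<Sum>i<?n. \<bar>cols X ! k ! i * (w s k i - w t k i)\<bar>)"
    by (intro order_trans[OF sum_abs] sum_mono sum_abs)
  also have "\<dots> \<le> (\<Sum>k<K. \<Sum>i<?n. cols X ! k ! i * ?B)"
  proof (intro sum_mono)
    fix k i assume "k \<in> {..<K}" "i \<in> {..<?n}"
    then have ki: "k < K" "i < ?n" by auto
    have "\<bar>w s k i - w t k i\<bar> \<le> ?B"
      unfolding w_def
    proof (rule softmax_weight_lipschitz[OF ki(2)])
      fix j assume "j < ?n"
      then show "\<bar>ln (probs X ! k ! j) - ln (probs X ! k ! i)\<bar> \<le> bndp X"
        using log_prob_bounds[OF X ki] log_prob_bounds[OF X ki(1), of j] by linarith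
    qed
    then show "\<bar>cols X ! k ! i * (w s k i - w t k i)\<bar> \<le> cols X ! k ! i * ?B"
      unfolding abs_mult using instancesD(9)[OF X ki] by (intro mult_mono) auto
  qed
  also have "\<dots> \<le> (\<Sum>k<K. 1 * ?B)"
    unfolding sum_distrib_right[symmetric]
    using instancesD(3,10)[OF X] by (intro sum_mono mult_right_mono) auto
  finally show ?thesis by simp
qed

section \<open>Correctness and cost of evaluating payoffs and candidates\<close>

lemma val_payoff_cmp:
  assumes X: "X \<in> instances K" and y: "length y = ndim X"
  shows "val (payoff_cmp X y \<sigma>) = payoff X y \<sigma>"
proof -
  have z: "map2 (\<lambda>a b. a - \<sigma> * ln b) y (probs X ! k) =
      map (\<lambda>i. y ! i - \<sigma> * ln (probs X ! k ! i)) [0..<ndim X]" if "k < K" for k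
    using that y instancesD(6)[OF X] by (intro nth_equalityI) auto
  show ?thesis
    by (simp add: payoff_cmp_def payoff_def sum_list_sum_nth atLeast0LessThan
        instancesD[OF X] z val_dot_cmp y)
qed

text \<open>Per column, the \<open>ndim X\<close> entries cost three operations each for the
  exponents, three for the softmax and two for the inner product. The final sum adds one operation
  per column.\<close>

lemma ops_payoff_cmp:
  assumes X: "X \<in> instances K" and y: "length y = ndim X"
  shows "ops (payoff_cmp X y \<sigma>) = K * (8 * ndim X + 1)"
proof -
  have z: "ops (map2_cmp (\<lambda>a b. bind_cmp (op1 (ln b)) (\<lambda>l. bind_cmp (op1 (\<sigma> * l)) (\<lambda>m. op1 (a - m)))) y p)
      = 3 * ndim X" if "length p = ndim X" for p
    using that y by (subst ops_map2_cmp_const[where c = 3]) auto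
  show ?thesis
    unfolding payoff_cmp_def
  proof (simp only: ops_bind_cmp, subst ops_map2_cmp_const[where c = "8 * ndim X"])
    fix p u assume "(p, u) \<in> set (zip (probs X) (cols X))"
    then have len: "length p = ndim X" "length u = ndim X"
      using instancesD[OF X] by (auto simp: set_zip)
    then show "ops (bind_cmp (map2_cmp (\<lambda>a b. bind_cmp (op1 (ln b))
        (\<lambda>l. bind_cmp (op1 (\<sigma> * l)) (\<lambda>m. op1 (a - m)))) y p)
        (\<lambda>z. bind_cmp (softmax_cmp z) (dot_cmp u))) = 8 * ndim X"
      by (simp add: z y ops_dot_cmp)
  qed (simp add: instancesD[OF X])
qed

lemma val_candidate_cmp:
  "val (candidate_cmp app X (\<epsilon> / (2 * real (length (probs X)))) \<sigma>) = candidate app X \<epsilon> \<sigma>"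
  by (simp add: candidate_cmp_def candidate_def fvecs_def thetas_def)

text \<open>The powers and the products cost \<open>K * ndim X\<close> each, the final logarithms
  \<open>ndim X\<close>. The remaining four operations are two negations and the two ends of the
  box.\<close>

lemma ops_candidate_cmp:
  fixes app :: lfp_solver and \<sigma> \<delta> :: real
  assumes X: "X \<in> instances K"
  defines "run \<equiv> app (exp (- bndy X)) (exp (bndy X)) (thetas X \<sigma>) (fvecs X \<sigma>) \<delta>"
  assumes q: "length (val run) = ndim X"
  shows "ops (candidate_cmp app X \<delta> \<sigma>) = (2 * K + 1) * ndim X + 4 + ops run"
proof -
  have fs: "map (map (\<lambda>x. x powr - \<sigma>)) (probs X) = fvecs X \<sigma>"
    by (simp add: fvecs_def)
  have ts: "map2 (map2 (*)) (fvecs X \<sigma>) (cols X) = thetas X \<sigma>"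
    by (simp add: thetas_def)
  have f: "ops (map_cmp (map_cmp (\<lambda>x. op1 (x powr - \<sigma>))) (probs X)) = K * ndim X"
    using instancesD[OF X]
    by (subst ops_map_cmp_const[where c = "ndim X"])
      (auto simp: ops_map_cmp_const[where c = 1] in_set_conv_nth)
  have t: "ops (map2_cmp (map2_cmp (\<lambda>a b. op1 (a * b))) (fvecs X \<sigma>) (cols X)) = K * ndim X"
    using instancesD[OF X]
    by (subst ops_map2_cmp_const[where c = "ndim X"])
      (auto simp: ops_map2_cmp_const[where c = 1] set_zip fvecs_def)
  show ?thesis
    using q unfolding candidate_cmp_def
    by (simp add: f t fs ts run_def ops_map_cmp_const[where c = 1] algebra_simps)
qed


section \<open>The grid search\<close>

text \<open>Identifies the grid, specified as an intersection with an interval, with the finite list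
  that the program enumerates.\<close>

lemma sigma_grid_eq:
  assumes "0 \<le> bnds X" "0 \<le> bndp X" "0 < \<epsilon>"
  defines "h \<equiv> \<epsilon> / (real (length (probs X)) * bndp X)"
  shows "sigma_grid X \<epsilon> = set (map (\<lambda>j. - 1 + real j * h) [0..<Suc (nat \<lfloor>(bnds X + 1) / h\<rfloor>)])"
proof -
  have h: "0 \<le> h"
    using assms by simp
  show ?thesis
  proof (cases "h = 0")
    \<comment> \<open>Since \<open>x / 0 = 0\<close>, the list has the single index 0, and both
      sides are \<open>{-1}\<close>.\<close>
    case True
    then show ?thesis
      using assms(1) by (auto simp: sigma_grid_def h_def[symmetric])
  next
    case False
    with h have h: "0 < h" by simp
    \<comment> \<open>Only the upper end of the interval restricts the index; the bound is attained,
      hence the \<open>Suc\<close>.\<close>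
    have iff: "- 1 + real j * h \<le> bnds X \<longleftrightarrow> j < Suc (nat \<lfloor>(bnds X + 1) / h\<rfloor>)" for j
    proof -
      have "- 1 + real j * h \<le> bnds X \<longleftrightarrow> real j \<le> (bnds X + 1) / h"
        using h by (simp add: field_simps)
      also have "\<dots> \<longleftrightarrow> int j \<le> \<lfloor>(bnds X + 1) / h\<rfloor>"
        by (simp add: le_floor_iff)
      also have "\<dots> \<longleftrightarrow> j < Suc (nat \<lfloor>(bnds X + 1) / h\<rfloor>)"
        using assms(1) h by (simp add: less_Suc_eq_le le_nat_iff)
      finally show ?thesis .
    qed
    have upt: "{f j |j. j < M} = set (map f [0..<M])" for f :: "nat \<Rightarrow> real" and M
      by auto
    have "sigma_grid X \<epsilon> = {- 1 + real j * h |j. - 1 + real j * h \<le> bnds X}"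
      unfolding sigma_grid_def Let_def h_def[symmetric] using h by auto
    then show ?thesis
      by (simp only: iff upt)
  qed
qed

text \<open>Rounding down to the grid moves \<sigma> by at most the mesh. The error is stated as a
  product with \<open>K * bndp X\<close>, the form the Lipschitz bound consumes, so that the case of
  mesh \<open>0\<close> is covered as well.\<close>

lemma sigma_grid_approx:
  assumes "0 \<le> bndp X" "0 < \<epsilon>" "\<sigma> \<in> {-1..bnds X}"
  obtains \<sigma>' where "\<sigma>' \<in> sigma_grid X \<epsilon>" "real (length (probs X)) * bndp X * \<bar>\<sigma> - \<sigma>'\<bar> \<le> \<epsilon>"
proof (cases "real (length (probs X)) * bndp X = 0")
  case True
  then have "- 1 \<in> sigma_grid X \<epsilon>"
    using assms by (auto simp: sigma_grid_def)
  then show ?thesis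
    by (rule that) (use assms(2) in \<open>simp only: True mult_zero_left less_imp_le\<close>)
next
  case False
  define L where "L = real (length (probs X)) * bndp X"
  define h where "h = \<epsilon> / L"
  have L: "0 < L"
    using False assms(1) unfolding L_def by (metis less_eq_real_def mult_nonneg_nonneg of_nat_0_le_iff)
  then have h: "0 < h"
    using assms(2) by (simp add: h_def)
  \<comment> \<open>The last grid point not above \<sigma>; rounding down keeps it below
    \<open>bnds X\<close>.\<close>
  define j where "j = nat \<lfloor>(\<sigma> + 1) / h\<rfloor>"
  define \<sigma>' where "\<sigma>' = - 1 + real j * h"
  have "0 \<le> (\<sigma> + 1) / h"
    using h assms(3) by simp
  then have "real j \<le> (\<sigma> + 1) / h" "(\<sigma> + 1) / h < real j + 1"
    unfolding j_def by linarith+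
  then have le: "\<sigma>' \<le> \<sigma>" "\<sigma> \<le> \<sigma>' + h"
    using h by (simp_all add: \<sigma>'_def field_simps)
  have "\<sigma>' \<in> sigma_grid X \<epsilon>"
  proof -
    have "- 1 \<le> \<sigma>'" "\<sigma>' \<le> bnds X"
      using le h assms(3) by (auto simp: \<sigma>'_def)
    then show ?thesis
      unfolding sigma_grid_def Let_def L_def[symmetric] h_def[symmetric] by (auto simp: \<sigma>'_def)
  qed
  moreover have "L * \<bar>\<sigma> - \<sigma>'\<bar> \<le> L * h"
    using le L by (intro mult_left_mono) auto
  then have "L * \<bar>\<sigma> - \<sigma>'\<bar> \<le> \<epsilon>"
    using L by (simp add: h_def)
  ultimately show ?thesis
    using that by (simp add: L_def)
qed

section \<open>The approximation guarantee\<close>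

lemma AppLFMP_run:
  assumes app: "is_AppLFMP K app" and X: "X \<in> instances K" and "\<sigma> \<in> {-1..bnds X}" "\<delta> \<in> {0<..<1}"
  defines "run \<equiv> app (exp (- bndy X)) (exp (bndy X)) (thetas X \<sigma>) (fvecs X \<sigma>) \<delta>"
  shows "val run \<in> lfp_box X"
    and "real K - lfp_obj X \<sigma> (val run) \<le> (1 + \<delta>) * (real K - lfp_max X \<sigma>)"
  using assms by (auto simp: is_AppLFMP_def Let_def)

text \<open>The contract of the subroutine speaks of tolerances in the open unit interval
  only.\<close>

lemma tolerance_bounds:
  assumes "1 \<le> K" "\<epsilon> \<in> {0<..<1::real}"
  shows "\<epsilon> / (2 * real K) \<in> {0<..<1}"
  using assms by (simp add: field_simps)

lemma candidate_spec:
  assumes K: "1 \<le> K" and app: "is_AppLFMP K app" and X: "X \<in> instances K"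
    and \<epsilon>: "\<epsilon> \<in> {0<..<1}" and \<sigma>: "\<sigma> \<in> {-1..bnds X}"
  shows "candidate app X \<epsilon> \<sigma> \<in> vec_box (ndim X) (- bndy X) (bndy X)"
    and "lfp_max X \<sigma> - \<epsilon> / 2 \<le> payoff X (candidate app X \<epsilon> \<sigma>) \<sigma>"
proof -
  define \<delta> where "\<delta> = \<epsilon> / (2 * real K)"
  define q where "q = val (app (exp (- bndy X)) (exp (bndy X)) (thetas X \<sigma>) (fvecs X \<sigma>) \<delta>)"
  have \<delta>: "\<delta> \<in> {0<..<1}"
    unfolding \<delta>_def using K \<epsilon> by (rule tolerance_bounds)
  note run = AppLFMP_run[OF app X \<sigma> \<delta>, folded q_def]
  have c: "candidate app X \<epsilon> \<sigma> = map ln q"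
    by (simp add: candidate_def q_def \<delta>_def instancesD(4)[OF X])
  show "candidate app X \<epsilon> \<sigma> \<in> vec_box (ndim X) (- bndy X) (bndy X)"
    unfolding c vec_box_def
  proof (intro CollectI conjI allI impI)
    show "length (map ln q) = ndim X"
      using run(1) by (simp add: lfp_box_def vec_box_def)
    fix i assume i: "i < ndim X"
    then have "exp (- bndy X) \<le> q ! i" "q ! i \<le> exp (bndy X)" "length q = ndim X"
      using run(1) by (auto simp: lfp_box_def vec_box_def)
    then show "- bndy X \<le> map ln q ! i" "map ln q ! i \<le> bndy X"
      using i lfp_box_pos[OF run(1) i] ln_le_cancel_iff[of "q ! i" "exp (bndy X)"]
      by (simp_all add: ln_ge_iff)
  qed
  \<comment> \<open>The contract allows a loss of \<delta> times the optimal value of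
    \<open>K - \<vartheta>\<close>, which is at most \<open>K\<close>.\<close>
  have "\<delta> * (real K - lfp_max X \<sigma>) \<le> \<delta> * real K"
    using \<delta> lfp_max_nonneg[OF X, of \<sigma>] by (intro mult_left_mono) auto
  also have "\<dots> = \<epsilon> / 2"
    using K by (simp add: \<delta>_def)
  finally show "lfp_max X \<sigma> - \<epsilon> / 2 \<le> payoff X (candidate app X \<epsilon> \<sigma>) \<sigma>"
    using run(2) unfolding c payoff_ln[OF X run(1)] by (simp add: algebra_simps)
qed

text \<open>An optimal pair is compared with the output in three moves: round its second component
  to a grid point \<open>s\<close>, pass to the candidate at \<open>s\<close>, and use maximality
  over the grid. Any way of breaking ties is covered.\<close>

lemma grid_search_output_approx:
  assumes K: "1 \<le> K" and app: "is_AppLFMP K app" and X: "X \<in> instances K"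
    and \<epsilon>: "\<epsilon> \<in> {0<..<1}" and out: "grid_search_output app X \<epsilon> (y, \<sigma>)"
  shows "y \<in> vec_box (ndim X) (- bndy X) (bndy X)" "\<sigma> \<in> {-1..bnds X}"
    "payoff_max X - \<epsilon> \<le> payoff X y \<sigma>"
proof -
  have grid: "\<And>s. s \<in> sigma_grid X \<epsilon> \<Longrightarrow> s \<in> {-1..bnds X}"
    by (auto simp: sigma_grid_def Let_def)
  have \<sigma>: "\<sigma> \<in> sigma_grid X \<epsilon>" and y: "y = candidate app X \<epsilon> \<sigma>"
    and max: "\<And>s. s \<in> sigma_grid X \<epsilon> \<Longrightarrow> payoff X (candidate app X \<epsilon> s) s \<le> payoff X y \<sigma>"
    using out by (auto simp: grid_search_output_def is_arg_max_linorder)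
  show "\<sigma> \<in> {-1..bnds X}"
    using \<sigma> by (rule grid)
  then show "y \<in> vec_box (ndim X) (- bndy X) (bndy X)"
    unfolding y by (rule candidate_spec(1)[OF K app X \<epsilon>])
  obtain y' \<sigma>' where opt: "y' \<in> vec_box (ndim X) (- bndy X) (bndy X)" "\<sigma>' \<in> {-1..bnds X}"
    "payoff X y' \<sigma>' = payoff_max X"
    using payoff_max_attained[OF X] by metis
  obtain s where s: "s \<in> sigma_grid X \<epsilon>" "real K * bndp X * \<bar>\<sigma>' - s\<bar> \<le> \<epsilon>"
    using sigma_grid_approx[of X \<epsilon> \<sigma>'] instancesD[OF X] \<epsilon> opt(2) by auto
  \<comment> \<open>Here \<open>y'\<close> is kept while \<open>\<sigma>'\<close> is replaced by
    \<open>s\<close>. It remains feasible at \<open>s\<close> and so competes in the fractional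
    program there.\<close>
  have "payoff_max X - \<epsilon> / 4 \<le> payoff X y' s"
  proof -
    have "real K * bndp X / 4 * \<bar>\<sigma>' - s\<bar> \<le> \<epsilon> / 4"
      using s(2) by simp
    then show ?thesis
      using payoff_lipschitz[OF X, of y' \<sigma>' s] opt(3) by linarith
  qed
  also have "\<dots> \<le> lfp_max X s"
    using opt(1) by (rule payoff_le_lfp_max[OF X])
  also have "\<dots> - \<epsilon> / 2 \<le> payoff X (candidate app X \<epsilon> s) s"
    by (rule candidate_spec(2)[OF K app X \<epsilon> grid[OF s(1)]])
  also have "\<dots> \<le> payoff X y \<sigma>"
    by (rule max[OF s(1)])
  \<comment> \<open>The losses add up to three quarters of \<epsilon>.\<close>
  finally show "payoff_max X - \<epsilon> \<le> payoff X y \<sigma>"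
    using \<epsilon> by simp
qed

section \<open>The executable program and its running time\<close>

text \<open>Ties the program to the specification of admissible outputs, and thereby shows that such
  an output exists.\<close>

lemma grid_search_output_val:
  assumes K: "1 \<le> K" and app: "is_AppLFMP K app" and X: "X \<in> instances K" and \<epsilon>: "\<epsilon> \<in> {0<..<1}"
  shows "grid_search_output app X \<epsilon> (val (grid_search app X \<epsilon>))"
proof -
  define h where "h = \<epsilon> / (real (length (probs X)) * bndp X)"
  define grid where "grid = map (\<lambda>j. - 1 + real j * h) [0..<Suc (nat \<lfloor>(bnds X + 1) / h\<rfloor>)]"
  define cs where "cs = map (\<lambda>\<sigma>. ((candidate app X \<epsilon> \<sigma>, \<sigma>), payoff X (candidate app X \<epsilon> \<sigma>) \<sigma>)) grid"
  have grid: "set grid = sigma_grid X \<epsilon>"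
    using sigma_grid_eq[OF instancesD(2,3)[OF X], of \<epsilon>] \<epsilon>
    by (simp only: grid_def h_def greaterThanLessThan_iff)
  have grid_val: "val (grid_cmp (nat \<lfloor>(bnds X + 1) / h\<rfloor>) h (- 1)) = grid"
    by (simp only: val_grid_cmp grid_def)
  \<comment> \<open>The grid always contains \<open>-1\<close>, so \<open>hd cs\<close> in the
    program is meaningful.\<close>
  have ne: "cs \<noteq> []"
    by (simp add: cs_def grid_def)
  \<comment> \<open>Zipping would cut off a short vector, so \<open>payoff_cmp\<close> agrees with
    \<open>payoff\<close> only once the length is known.\<close>
  have len: "length (candidate app X \<epsilon> \<sigma>) = ndim X" if "\<sigma> \<in> set grid" for \<sigma>
    using candidate_spec(1)[OF K app X \<epsilon>, of \<sigma>] that unfolding grid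
    by (auto simp: sigma_grid_def Let_def vec_box_def)
  have cs: "map (\<lambda>\<sigma>. ((candidate app X \<epsilon> \<sigma>, \<sigma>), val (payoff_cmp X (candidate app X \<epsilon> \<sigma>) \<sigma>))) grid = cs"
    unfolding cs_def using len by (auto simp: val_payoff_cmp[OF X])
  have "val (grid_search app X \<epsilon>) = val (argmax_cmp (hd cs) (tl cs))"
    by (simp add: grid_search_def floor_cmp_def val_candidate_cmp h_def[symmetric] grid_val cs)
  moreover obtain d where d: "d \<in> set cs" "val (argmax_cmp (hd cs) (tl cs)) = fst d"
    "\<And>e. e \<in> set cs \<Longrightarrow> snd e \<le> snd d"
    using val_argmax_cmp[of "hd cs" "tl cs"] list.collapse[OF ne] by metis
  ultimately obtain \<sigma> where "\<sigma> \<in> set grid" "val (grid_search app X \<epsilon>) = (candidate app X \<epsilon> \<sigma>, \<sigma>)"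
    "\<And>s. s \<in> set grid \<Longrightarrow> payoff X (candidate app X \<epsilon> s) s \<le> payoff X (candidate app X \<epsilon> \<sigma>) \<sigma>"
    unfolding cs_def by fastforce
  then show ?thesis
    by (simp add: grid_search_output_def is_arg_max_linorder grid)
qed

text \<open>With \<open>A\<close> bounding one call of the subroutine, each of the
  \<open>N + 1\<close> grid points costs at most \<open>(10 * K + 1) * ndim X + K + 4 + A\<close>.
  The overhead \<open>3 * N + 7\<close> is absorbed by raising 4 to 13.\<close>

lemma ops_grid_search_le:
  assumes K: "1 \<le> K" and app: "is_AppLFMP K app" and X: "X \<in> instances K" and \<epsilon>: "\<epsilon> \<in> {0<..<1}"
    and A: "\<And>\<sigma>. \<sigma> \<in> {-1..bnds X} \<Longrightarrow>
      ops (app (exp (- bndy X)) (exp (bndy X)) (thetas X \<sigma>) (fvecs X \<sigma>) (\<epsilon> / (2 * real K))) \<le> A"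
  defines "N \<equiv> nat \<lfloor>(bnds X + 1) * (real K * bndp X) / \<epsilon>\<rfloor>"
  shows "ops (grid_search app X \<epsilon>) \<le> (N + 1) * ((10 * K + 1) * ndim X + K + 13 + A)"
proof -
  let ?n = "ndim X" and ?\<delta> = "\<epsilon> / (2 * real K)"
  define h where "h = \<epsilon> / (real (length (probs X)) * bndp X)"
  define grid where "grid = map (\<lambda>j. - 1 + real j * h) [0..<Suc N]"
  have len_probs: "length (probs X) = K"
    using X by (rule instancesD)
  have N: "nat \<lfloor>(bnds X + 1) / h\<rfloor> = N"
    by (simp add: N_def h_def len_probs)
  have grid: "set grid = sigma_grid X \<epsilon>"
    using sigma_grid_eq[OF instancesD(2,3)[OF X], of \<epsilon>] \<epsilon>
    by (simp only: grid_def h_def[symmetric] N greaterThanLessThan_iff)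
  define f where "f = (\<lambda>\<sigma>. bind_cmp (candidate_cmp app X ?\<delta> \<sigma>) (\<lambda>y.
    bind_cmp (payoff_cmp X y \<sigma>) (\<lambda>v. ret ((y, \<sigma>), v))))"
  have "ops (f \<sigma>) \<le> (10 * K + 1) * ?n + K + 4 + A" if "\<sigma> \<in> set grid" for \<sigma>
  proof -
    have \<sigma>: "\<sigma> \<in> {-1..bnds X}"
      using that unfolding grid by (auto simp: sigma_grid_def Let_def)
    have c: "length (candidate app X \<epsilon> \<sigma>) = ?n"
      using candidate_spec(1)[OF K app X \<epsilon> \<sigma>] by (simp add: vec_box_def)
    have "val (candidate_cmp app X ?\<delta> \<sigma>) = candidate app X \<epsilon> \<sigma>"
      using val_candidate_cmp[of app X \<epsilon> \<sigma>] by (simp add: len_probs)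
    moreover have "ops (candidate_cmp app X ?\<delta> \<sigma>) \<le> (2 * K + 1) * ?n + 4 + A"
      using A[OF \<sigma>] c ops_candidate_cmp[OF X, of app \<sigma> ?\<delta>] by (simp add: candidate_def len_probs)
    ultimately show ?thesis
      using ops_payoff_cmp[OF X c, of \<sigma>] by (simp add: f_def algebra_simps)
  qed
  then have "ops (map_cmp f grid) \<le> length grid * ((10 * K + 1) * ?n + K + 4 + A)"
    by (rule ops_map_cmp_le)
  \<comment> \<open>Six scalar operations, \<open>N + 1\<close> comparisons for the floor,
    \<open>N\<close> additions for the grid and \<open>N\<close> comparisons for the
    maximum.\<close>
  moreover have "ops (grid_search app X \<epsilon>) = 3 * N + 7 + ops (map_cmp f grid)"
  proof -
    have "val (grid_cmp N h (- 1)) = grid"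
      by (simp only: val_grid_cmp grid_def)
    moreover have "length grid = N + 1"
      by (simp add: grid_def)
    ultimately show ?thesis
      by (simp add: grid_search_def floor_cmp_def N_def[symmetric] h_def f_def len_probs)
  qed
  ultimately show ?thesis
    by (simp add: grid_def algebra_simps)
qed

text \<open>The number of grid points supplies one factor \<open>1 / \<epsilon>\<close> and the
  subroutine the other \<open>K\<close>. In \<open>1 + params X\<close> the grid contributes degree
  2 and each point degree \<open>m + 1\<close>.\<close>

lemma soft_O_grid_search:
  assumes K: "1 \<le> K" and app: "is_AppLFMP K app"
  shows "soft_O {(X, \<epsilon>). X \<in> instances K \<and> \<epsilon> \<in> {0<..<1}} (\<lambda>(X, \<epsilon>). params X)
    (\<lambda>(X, \<epsilon>). real (ops (grid_search app X \<epsilon>))) (\<lambda>(X, \<epsilon>). (1 / \<epsilon>) ^ (K + 1))"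
proof -
  obtain C m where Cm: "\<And>X \<sigma> \<delta>. X \<in> instances K \<Longrightarrow> \<sigma> \<in> {-1..bnds X} \<Longrightarrow> \<delta> \<in> {0<..<1} \<Longrightarrow>
      real (ops (app (exp (- bndy X)) (exp (bndy X)) (thetas X \<sigma>) (fvecs X \<sigma>) \<delta>))
        \<le> C * (1 + params X) ^ m * (1 / \<delta>) ^ K"
    using app by (fastforce simp: is_AppLFMP_def Let_def soft_O_def)
  \<comment> \<open>The factor \<open>(2 * K) ^ K\<close> converts the inner tolerance to
    \<epsilon>; \<open>\<bar>C\<bar>\<close> is used because the contract does not fix the sign of
    \<open>C\<close>.\<close>
  define B where "B = \<bar>C\<bar> * (2 * real K) ^ K"
  \<comment> \<open>The sum of \<open>10 * K + 1\<close> and \<open>K + 13\<close>, the coefficients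
    of the cost per point apart from the subroutine.\<close>
  define E where "E = 11 * real K + 14"
  have "real (ops (grid_search app X \<epsilon>)) \<le>
      real K * (E + B) * (1 + params X) ^ (m + 3) * (1 / \<epsilon>) ^ (K + 1)"
    if X: "X \<in> instances K" and \<epsilon>: "\<epsilon> \<in> {0<..<1}" for X \<epsilon>
  proof -
    let ?P = "params X"
    note inst = instancesD[OF X]
    have P: "0 \<le> ?P" "real (ndim X) \<le> ?P" "bnds X \<le> ?P" "bndp X \<le> ?P"
      using inst(1-3) by (auto simp: params_def)
    have e: "1 \<le> 1 / \<epsilon>" "0 < \<epsilon>"
      using \<epsilon> by auto
    define R where "R = B * (1 + ?P) ^ m * (1 / \<epsilon>) ^ K"
    have R: "0 \<le> R"
      using P e by (simp add: R_def B_def)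
    define N where "N = nat \<lfloor>(bnds X + 1) * (real K * bndp X) / \<epsilon>\<rfloor>"
    have "real (ops (app (exp (- bndy X)) (exp (bndy X)) (thetas X \<sigma>) (fvecs X \<sigma>) (\<epsilon> / (2 * real K)))) \<le> R"
      if \<sigma>: "\<sigma> \<in> {-1..bnds X}" for \<sigma>
    proof -
      have "C * (1 + ?P) ^ m * (1 / (\<epsilon> / (2 * real K))) ^ K \<le>
          \<bar>C\<bar> * (1 + ?P) ^ m * (1 / (\<epsilon> / (2 * real K))) ^ K"
        using P e by (intro mult_right_mono) auto
      also have "\<dots> = R"
        by (simp add: R_def B_def power_divide power_mult_distrib)
      finally show ?thesis
        using Cm[OF X \<sigma> tolerance_bounds[OF K \<epsilon>]] by linarith
    qed
    then have "ops (grid_search app X \<epsilon>) \<le> (N + 1) * ((10 * K + 1) * ndim X + K + 13 + nat \<lfloor>R\<rfloor>)"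
      unfolding N_def using R
      by (intro ops_grid_search_le[OF K app X \<epsilon>]) (simp add: le_nat_floor)
    then have "real (ops (grid_search app X \<epsilon>)) \<le>
        real ((N + 1) * ((10 * K + 1) * ndim X + K + 13 + nat \<lfloor>R\<rfloor>))"
      by (simp only: of_nat_le_iff)
    also have "\<dots> = (real N + 1) * ((10 * real K + 1) * real (ndim X) + real K + 13 + real (nat \<lfloor>R\<rfloor>))"
      by (simp add: algebra_simps)
    also have "\<dots> \<le> (real K * (1 + ?P)\<^sup>2 * (1 / \<epsilon>)) * ((E + B) * (1 + ?P) ^ (m + 1) * (1 / \<epsilon>) ^ K)"
    proof (intro mult_mono)
      have "real N \<le> (bnds X + 1) * (real K * bndp X) / \<epsilon>"
        unfolding N_def using inst(2,3) e by (intro of_nat_floor) auto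
      also have "\<dots> \<le> (?P + 1) * (real K * ?P) / \<epsilon>"
        using P inst(2,3) e by (intro divide_right_mono mult_mono) auto
      finally have "real N \<le> (?P + 1) * (real K * ?P) / \<epsilon>" .
      \<comment> \<open>Bounds the extra grid point in a form that completes
        \<open>(?P + 1) * ?P\<close> to the square of \<open>1 + ?P\<close>.\<close>
      moreover have "1 * 1 * 1 \<le> (?P + 1) * real K * (1 / \<epsilon>)"
        using P K e by (intro mult_mono) auto
      ultimately have "real N + 1 \<le> (?P + 1) * (real K * ?P) / \<epsilon> + (?P + 1) * real K * (1 / \<epsilon>)"
        by linarith
      also have "\<dots> = real K * (1 + ?P)\<^sup>2 * (1 / \<epsilon>)"
        using e by (simp add: field_simps power2_eq_square)
      finally show "real N + 1 \<le> real K * (1 + ?P)\<^sup>2 * (1 / \<epsilon>)" .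
      have "(10 * real K + 1) * real (ndim X) + real K + 13 \<le> (10 * real K + 1) * ?P + real K + 13"
        using P by (intro add_mono mult_left_mono) auto
      \<comment> \<open>The two units are placeholders for the powers that replace them in the next
        step.\<close>
      also have "\<dots> \<le> E * (1 + ?P) * 1 * 1"
        using P by (simp add: E_def algebra_simps)
      also have "\<dots> \<le> E * (1 + ?P) * (1 + ?P) ^ m * (1 / \<epsilon>) ^ K"
        using P e by (intro mult_mono one_le_power) (auto simp: E_def)
      finally have "(10 * real K + 1) * real (ndim X) + real K + 13 \<le> E * (1 + ?P) ^ (m + 1) * (1 / \<epsilon>) ^ K"
        by (simp add: mult_ac)
      moreover have "real (nat \<lfloor>R\<rfloor>) \<le> B * (1 + ?P) ^ (m + 1) * (1 / \<epsilon>) ^ K"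
      proof -
        have "real (nat \<lfloor>R\<rfloor>) \<le> R"
          using R by (rule of_nat_floor)
        also have "\<dots> \<le> B * (1 + ?P) ^ (m + 1) * (1 / \<epsilon>) ^ K"
          unfolding R_def using P e
          by (intro mult_right_mono mult_left_mono power_increasing) (auto simp: B_def)
        finally show ?thesis .
      qed
      ultimately show "(10 * real K + 1) * real (ndim X) + real K + 13 + real (nat \<lfloor>R\<rfloor>)
          \<le> (E + B) * (1 + ?P) ^ (m + 1) * (1 / \<epsilon>) ^ K"
        by (simp only: distrib_right)
    qed (use P e in auto)
    also have "\<dots> = real K * (E + B) * (1 + ?P) ^ (m + 3) * (1 / \<epsilon>) ^ (K + 1)"
      by (simp add: power_add power2_eq_square power3_eq_cube mult_ac)
    finally show ?thesis .
  qed
  then show ?thesis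
    unfolding soft_O_def
    by (intro exI[where x = "real K * (E + B)"] exI[where x = "m + 3"]) auto
qed

theorem theoremD3:
  fixes K :: nat and AppLFMP :: lfp_solver
  assumes "1 \<le> K"
    and "is_AppLFMP K AppLFMP"
  shows "(\<forall>X \<in> instances K. \<forall>\<epsilon> \<in> {0<..<1}.
            grid_search_output AppLFMP X \<epsilon> (val (grid_search AppLFMP X \<epsilon>)) \<and>
            (\<forall>y \<sigma>. grid_search_output AppLFMP X \<epsilon> (y, \<sigma>) \<longrightarrow>
               y \<in> vec_box (ndim X) (- bndy X) (bndy X) \<and> \<sigma> \<in> {-1..bnds X} \<and>
               payoff X y \<sigma> \<ge> payoff_max X - \<epsilon>)) \<and>
         soft_O {(X, \<epsilon>). X \<in> instances K \<and> \<epsilon> \<in> {0<..<1}}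
                (\<lambda>(X, \<epsilon>). params X)
                (\<lambda>(X, \<epsilon>). real (ops (grid_search AppLFMP X \<epsilon>)))
                (\<lambda>(X, \<epsilon>). (1 / \<epsilon>) ^ (K + 1))"
proof (intro conjI ballI allI impI)
  fix X \<epsilon> assume X: "X \<in> instances K" and \<epsilon>: "\<epsilon> \<in> {0<..<1::real}"
  show "grid_search_output AppLFMP X \<epsilon> (val (grid_search AppLFMP X \<epsilon>))"
    by (rule grid_search_output_val[OF assms X \<epsilon>])
  fix y \<sigma> assume out: "grid_search_output AppLFMP X \<epsilon> (y, \<sigma>)"
  show "y \<in> vec_box (ndim X) (- bndy X) (bndy X)" "\<sigma> \<in> {-1..bnds X}"
    "payoff_max X - \<epsilon> \<le> payoff X y \<sigma>"
    by (rule grid_search_output_approx[OF assms X \<epsilon> out])+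
qed (rule soft_O_grid_search[OF assms])

end
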